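(* Let $G=N\rtimes T$ be the semidirect product of a normal subgroup $N$ and a subgroup $T$, and let $M$ be a $G$-module. (a) Let $\underline{E}_N\colon M\overset{i_N}{\rightarrowtail}E_N\overset{\pi_N}{\twoheadrightarrow}N$ and $\underline{E}_T\colon M\overset{i_T}{\rightarrowtail}E_T\overset{\pi_T}{\twoheadrightarrow}T$ be group extensions and $\tilde\varphi\colon E_T\to\mathrm{Aut}^M(E_N)$ a homomorphism. If $(\underline{E}_N,\underline{E}_T,\tilde\varphi)$ is realizable, then the restricted extensions $\mathcal{E}(\underline{E}_N,\underline{E}_T,\tilde\varphi)_N$ and $\mathcal{E}(\underline{E}_N,\underline{E}_T,\tilde\varphi)_T$ are congruent with $\underline{E}_N$ and $\underline{E}_T$, respectively. (b) Any extension $\mathcal{E}\colon M\overset{i}{\rightarrowtail}E\overset{\pi}{\twoheadrightarrow}G$ of $G$ by $M$ is congruent with $\mathcal{E}(\mathcal{E}_N,\mathcal{E}_T,\tilde\varphi)$, where $\mathcal{E}_N,\mathcal{E}_T$ are the restrictions of $\mathcal{E}$ to $N$ and $T$, and $\tilde\varphi\colon\pi^{-1}(T)\to\mathrm{Aut}^M(\pi^{-1}(N))$ is given by conjugation in $E$, $\tilde\varphi(e_T)(e_N)=e_Te_Ne_T^{-1}$.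
   Context: An extension of a group $\Gamma$ by a $\Gamma$-module $M$ is a short exact sequence of groups $0\to M\xrightarrow{i}E\xrightarrow{\pi}\Gamma\to1$ such that $e\,i(m)\,e^{-1}=i(\pi(e)m)$. Two extensions of $\Gamma$ by $M$ are congruent if there is a homomorphism (hence isomorphism) between their middle groups commuting with the injections of $M$ and the projections to $\Gamma$. $M$ is regarded as an $N$- and $T$-module by restriction. For an extension $\mathcal{E}\colon M\overset{i}{\rightarrowtail}E\overset{\pi}{\twoheadrightarrow}G$, the restricted extensions are $\mathcal{E}_N\colon M\rightarrowtail\pi^{-1}(N)\twoheadrightarrow N$ and $\mathcal{E}_T\colon M\rightarrowtail\pi^{-1}(T)\twoheadrightarrow T$. $\mathrm{Aut}^M(E_N)=\{\epsilon\in\mathrm{Aut}(E_N)\mid\epsilon(i_NM)=i_NM\}$. Realizable: $(\underline{E}_N,\underline{E}_T,\tilde\varphi)$ is realizable if there exist an extension $M\overset{i}{\rightarrowtail}E\overset{\pi}{\twoheadrightarrow}G$ of $G$ by $M$ and homomorphisms $i_1\colon E_N\to E$, $i_2\colon E_T\to E$ with $i_1i_N=i=i_2i_T$, $\pi i_1=\iota_N\pi_N$, $\pi i_2=\iota_T\pi_T$ ($\iota_N,\iota_T$ the inclusions of $N,T$ in $G$) and $\tilde\varphi(e_T)(e_N)=i_1^{-1}\big(i_2(e_T)\,i_1(e_N)\,i_2(e_T)^{-1}\big)$ for all $e_T\in E_T$, $e_N\in E_N$. The extension $\mathcal{E}(\underline{E}_N,\underline{E}_T,\tilde\varphi)$: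 for a realizable triple, form the semidirect product $E_N\rtimes_{\tilde\varphi}E_T$, with multiplication $(e_N,e_T)(e_N',e_T')=(e_N\,\tilde\varphi(e_T)(e_N'),\,e_Te_T')$. The subset $\{(i_N(m),i_T(m)^{-1})\mid m\in M\}$ is a normal subgroup; let $E$ be the quotient group and $q\colon E_N\rtimes_{\tilde\varphi}E_T\twoheadrightarrow E$ the projection. Then $\mathcal{E}(\underline{E}_N,\underline{E}_T,\tilde\varphi)$ is the extension $M\overset{i}{\rightarrowtail}E\overset{\pi}{\twoheadrightarrow}G$ with $i(m)=q(i_N(m),1)=q(1,i_T(m))$ and $\pi(q(e_N,e_T))=\pi_N(e_N)\,\pi_T(e_T)$. *)

theory Defs
  imports "HOL-Algebra.Coset" "HOL-Algebra.Bij"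
begin

text \<open>
  Groups are those of HOL-Algebra. Modules are written multiplicatively. A subgroup \<open>S\<close> of \<open>G\<close>,
  regarded as a group in its own right, is \<open>G\<lparr>carrier := S\<rparr>\<close>, and the restriction of a
  \<open>G\<close>-module to \<open>S\<close> is given by the same map \<open>act\<close>. All maps matter only on
  carriers; automorphisms, as in \<open>AutoGroup\<close>, are moreover \<open>extensional\<close>.
\<close>

locale group_module = \<Gamma>: group \<Gamma> + M: comm_group M
  for \<Gamma> :: "'g monoid" and M :: "'m monoid" +
  fixes act :: "'g \<Rightarrow> 'm \<Rightarrow> 'm"
  assumes act_hom: "act \<in> hom \<Gamma> (AutoGroup M)"

record ('m, 'e, 'g) ext_data =
  middle :: "'e monoid"
  inj_map :: "'m \<Rightarrow> 'e"
  proj_map :: "'e \<Rightarrow> 'g"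

locale group_extension = group_module \<Gamma> M act
  for \<Gamma> :: "'g monoid" and M :: "'m monoid" and act :: "'g \<Rightarrow> 'm \<Rightarrow> 'm" +
  fixes X :: "('m, 'e, 'g) ext_data"
  assumes group_middle: "group (middle X)"
    and inj_map_mon: "inj_map X \<in> mon M (middle X)"
    and proj_map_epi: "proj_map X \<in> epi (middle X) \<Gamma>"
    and exact: "inj_map X ` carrier M = kernel (middle X) \<Gamma> (proj_map X)"
    and conj_act: "\<lbrakk>e \<in> carrier (middle X); m \<in> carrier M\<rbrakk> \<Longrightarrow>
      e \<otimes>\<^bsub>middle X\<^esub> inj_map X m \<otimes>\<^bsub>middle X\<^esub> inv\<^bsub>middle X\<^esub> e = inj_map X (act (proj_map X e) m)"

definition congruent_ext ::
  "'g monoid \<Rightarrow> 'm monoid \<Rightarrow> ('g \<Rightarrow> 'm \<Rightarrow> 'm) \<Rightarrow>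
   ('m, 'e, 'g) ext_data \<Rightarrow> ('m, 'f, 'g) ext_data \<Rightarrow> bool"
  where "congruent_ext \<Gamma> M act X Y \<longleftrightarrow>
    group_extension \<Gamma> M act X \<and> group_extension \<Gamma> M act Y \<and>
    (\<exists>f \<in> hom (middle X) (middle Y).
       (\<forall>m \<in> carrier M. f (inj_map X m) = inj_map Y m) \<and>
       (\<forall>e \<in> carrier (middle X). proj_map Y (f e) = proj_map X e))"

definition restrict_ext :: "('m, 'e, 'g) ext_data \<Rightarrow> 'g set \<Rightarrow> ('m, 'e, 'g) ext_data"
  where "restrict_ext X S =
    X\<lparr>middle := (middle X)\<lparr>carrier := {e \<in> carrier (middle X). proj_map X e \<in> S}\<rparr>\<rparr>"

definition AutM :: "'m monoid \<Rightarrow> ('m, 'e, 'g) ext_data \<Rightarrow> ('e \<Rightarrow> 'e) monoid"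
  where "AutM M X = (AutoGroup (middle X))
    \<lparr>carrier := {\<epsilon> \<in> auto (middle X). \<epsilon> ` (inj_map X ` carrier M) = inj_map X ` carrier M}\<rparr>"

text \<open>
  HOL cannot quantify existentially over types, so the type \<open>'e\<close> of the elements of the middle
  group \<open>E\<close> of the realizing extension is an explicit parameter. A theorem with a
  hypothesis \<open>realizable TYPE('e) \<dots>\<close>, polymorphic in \<open>'e\<close>, covers a realizing
  extension of any type.
\<close>

definition realizable ::
  "'e itself \<Rightarrow> 'g monoid \<Rightarrow> 'm monoid \<Rightarrow> ('g \<Rightarrow> 'm \<Rightarrow> 'm) \<Rightarrow>
   ('m, 'n, 'g) ext_data \<Rightarrow> ('m, 't, 'g) ext_data \<Rightarrow> ('t \<Rightarrow> 'n \<Rightarrow> 'n) \<Rightarrow> bool"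
  where "realizable _ G M act E\<^sub>N E\<^sub>T \<phi> \<longleftrightarrow>
    (\<exists>X :: ('m, 'e, 'g) ext_data. group_extension G M act X \<and>
     (\<exists>i\<^sub>1 \<in> hom (middle E\<^sub>N) (middle X). \<exists>i\<^sub>2 \<in> hom (middle E\<^sub>T) (middle X).
       (\<forall>m \<in> carrier M. i\<^sub>1 (inj_map E\<^sub>N m) = inj_map X m \<and> inj_map X m = i\<^sub>2 (inj_map E\<^sub>T m)) \<and>
       (\<forall>a \<in> carrier (middle E\<^sub>N). proj_map X (i\<^sub>1 a) = proj_map E\<^sub>N a) \<and>
       (\<forall>b \<in> carrier (middle E\<^sub>T). proj_map X (i\<^sub>2 b) = proj_map E\<^sub>T b) \<and>
       (\<forall>b \<in> carrier (middle E\<^sub>T). \<forall>a \<in> carrier (middle E\<^sub>N).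
          \<phi> b a = inv_into (carrier (middle E\<^sub>N)) i\<^sub>1
                    (i\<^sub>2 b \<otimes>\<^bsub>middle X\<^esub> i\<^sub>1 a \<otimes>\<^bsub>middle X\<^esub> inv\<^bsub>middle X\<^esub> (i\<^sub>2 b)))))"

definition semidirect_prod :: "'a monoid \<Rightarrow> 'b monoid \<Rightarrow> ('b \<Rightarrow> 'a \<Rightarrow> 'a) \<Rightarrow> ('a \<times> 'b) monoid"
  where "semidirect_prod A B \<phi> =
    \<lparr>carrier = carrier A \<times> carrier B,
     mult = \<lambda>(a, b) (a', b'). (a \<otimes>\<^bsub>A\<^esub> \<phi> b a', b \<otimes>\<^bsub>B\<^esub> b'),
     one = (\<one>\<^bsub>A\<^esub>, \<one>\<^bsub>B\<^esub>)\<rparr>"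

definition amalgamated_ext ::
  "'g monoid \<Rightarrow> 'm monoid \<Rightarrow> ('m, 'n, 'g) ext_data \<Rightarrow> ('m, 't, 'g) ext_data \<Rightarrow>
   ('t \<Rightarrow> 'n \<Rightarrow> 'n) \<Rightarrow> ('m, ('n \<times> 't) set, 'g) ext_data"
  where "amalgamated_ext G M E\<^sub>N E\<^sub>T \<phi> =
    (let S = semidirect_prod (middle E\<^sub>N) (middle E\<^sub>T) \<phi>;
         K = {(inj_map E\<^sub>N m, inv\<^bsub>middle E\<^sub>T\<^esub> (inj_map E\<^sub>T m)) | m. m \<in> carrier M};
         q = (\<lambda>x. K #>\<^bsub>S\<^esub> x)
     in \<lparr>middle = S Mod K,
         inj_map = (\<lambda>m. q (inj_map E\<^sub>N m, \<one>\<^bsub>middle E\<^sub>T\<^esub>)),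
         proj_map = (\<lambda>C. the_elem ((\<lambda>(a, b). proj_map E\<^sub>N a \<otimes>\<^bsub>G\<^esub> proj_map E\<^sub>T b) ` C))\<rparr>)"
    \<comment> \<open>the value of \<open>proj_map\<close> at a coset \<open>C\<close> is the common value at its representatives\<close>

definition conj_map :: "('m, 'e, 'g) ext_data \<Rightarrow> 'g set \<Rightarrow> 'e \<Rightarrow> 'e \<Rightarrow> 'e"
  where "conj_map X N b =
    (\<lambda>a \<in> carrier (middle (restrict_ext X N)). b \<otimes>\<^bsub>middle X\<^esub> a \<otimes>\<^bsub>middle X\<^esub> inv\<^bsub>middle X\<^esub> b)"

end

theory Submission
  imports Defs
begin

text \<open>
  Everything rests on one congruence. Let an extension \<open>X\<close> of \<open>G\<close> with middle group \<open>E\<close>, together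
  with \<open>i\<^sub>1\<close> and \<open>i\<^sub>2\<close>, realize the triple \<open>(A, B, \<phi>)\<close>. Since \<open>\<phi>\<close> is conjugation inside \<open>E\<close>, the map
  \<open>\<Phi> (a, b) = i\<^sub>1 a \<cdot> i\<^sub>2 b\<close> is a homomorphism from the semidirect product to \<open>E\<close>. It is onto because
  \<open>G = N T\<close>. If \<open>\<Phi> (a, b) = 1\<close>, then projecting to \<open>G\<close> and using that \<open>N\<close> and \<open>T\<close> meet trivially
  shows that \<open>a\<close> and \<open>b\<close> come from \<open>M\<close>, and then they are mutually inverse there; so the kernel of
  \<open>\<Phi>\<close> is exactly the subgroup divided out in the amalgamated extension. By the first isomorphism
  theorem \<open>\<Phi>\<close> induces an isomorphism from the amalgamated middle group to \<open>E\<close>, and it respects the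
  maps from \<open>M\<close> and to \<open>G\<close>. Hence the amalgamated extension is congruent with \<open>X\<close>
  (\<open>amalgamated_ext_congruent\<close>).

  Part (a) follows: restricting this congruence to \<open>N\<close>, the amalgamated extension becomes congruent
  with the restriction of \<open>X\<close>, which is congruent with \<open>A\<close> through \<open>i\<^sub>1\<close>; likewise for \<open>T\<close>. For part
  (b), an arbitrary extension \<open>X\<close> realizes the triple formed by its own restrictions and conjugation,
  \<open>i\<^sub>1\<close> and \<open>i\<^sub>2\<close> being the inclusions (\<open>inclusions_realize\<close>), so the same congruence applies, read
  backwards. Reading congruences backwards is possible because each of them is an isomorphism
  (\<open>congruence_iso\<close>).
\<close>

section \<open>Congruences of extensions\<close>

lemma (in group) inv_mult_cancel_left:
  "\<lbrakk>x \<in> carrier G; y \<in> carrier G\<rbrakk> \<Longrightarrow> inv x \<otimes> (x \<otimes> y) = y"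
  by (simp flip: m_assoc)

context group_extension
begin

sublocale middle: group "middle X"
  by (rule group_middle)

sublocale inj: group_hom M "middle X" "inj_map X"
  using inj_map_mon by (unfold_locales) (simp add: mon_def)

sublocale proj: group_hom "middle X" \<Gamma> "proj_map X"
  using proj_map_epi by (unfold_locales) (simp add: epi_def)

lemma proj_inj:
  assumes "m \<in> carrier M"
  shows "proj_map X (inj_map X m) = \<one>\<^bsub>\<Gamma>\<^esub>"
proof -
  have "inj_map X m \<in> kernel (middle X) \<Gamma> (proj_map X)"
    using assms by (simp flip: exact)
  then show ?thesis by (simp add: kernel_def)
qed

lemma proj_eq_oneE:
  assumes "e \<in> carrier (middle X)" and "proj_map X e = \<one>\<^bsub>\<Gamma>\<^esub>"
  obtains m where "m \<in> carrier M" and "e = inj_map X m"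
proof -
  have "e \<in> inj_map X ` carrier M"
    using assms exact by (simp add: kernel_def)
  then show thesis
    using that by blast
qed

lemma inj_map_inject:
  "m \<in> carrier M \<Longrightarrow> m' \<in> carrier M \<Longrightarrow> inj_map X m = inj_map X m' \<longleftrightarrow> m = m'"
  using inj_map_mon by (auto simp: mon_def inj_on_def)

lemma act_automorphism:
  assumes "g \<in> carrier \<Gamma>"
  shows "act g ` carrier M = carrier M"
proof -
  have "act g \<in> Bij (carrier M)"
    using act_hom assms by (auto simp: hom_def AutoGroup_def auto_def)
  then show ?thesis
    by (simp add: Bij_def bij_betw_def)
qed

end

text \<open>
  The short five lemma. An element killed by \<open>f\<close> projects to \<open>1\<close>, so it comes from \<open>M\<close>, where \<open>f\<close>
  acts as the injective map of \<open>Y\<close>. Any \<open>y\<close> differs from some \<open>f e\<close> lying over the same element of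
  \<open>\<Gamma>\<close> only by an element of \<open>M\<close>, which \<open>f\<close> also reaches.
\<close>

lemma congruence_iso:
  assumes "group_extension \<Gamma> M act X" and "group_extension \<Gamma> M act Y"
    and f: "f \<in> hom (middle X) (middle Y)"
    and inj: "\<And>m. m \<in> carrier M \<Longrightarrow> f (inj_map X m) = inj_map Y m"
    and proj: "\<And>e. e \<in> carrier (middle X) \<Longrightarrow> proj_map Y (f e) = proj_map X e"
  shows "f \<in> iso (middle X) (middle Y)"
proof -
  interpret X: group_extension \<Gamma> M act X by fact
  interpret Y: group_extension \<Gamma> M act Y by fact
  interpret f: group_hom "middle X" "middle Y" f
    using f by unfold_locales
  have "inj_on f (carrier (middle X))"
    unfolding f.inj_on_one_iff
  proof (intro allI impI)
    fix e assume e: "e \<in> carrier (middle X)" and fe: "f e = \<one>\<^bsub>middle Y\<^esub>"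
    have "proj_map X e = \<one>\<^bsub>\<Gamma>\<^esub>"
      using proj[OF e] fe by simp
    then obtain m where m: "m \<in> carrier M" "e = inj_map X m"
      using X.proj_eq_oneE[OF e] by blast
    then have "inj_map Y m = inj_map Y \<one>\<^bsub>M\<^esub>"
      using fe inj[OF m(1)] by simp
    then have "m = \<one>\<^bsub>M\<^esub>"
      using Y.inj_map_inject[OF m(1), of "\<one>\<^bsub>M\<^esub>"] by simp
    then show "e = \<one>\<^bsub>middle X\<^esub>"
      using m by simp
  qed
  moreover have "carrier (middle Y) \<subseteq> f ` carrier (middle X)"
  proof
    fix y assume y: "y \<in> carrier (middle Y)"
    have "proj_map Y y \<in> proj_map X ` carrier (middle X)"
      using y X.proj_map_epi by (simp add: epi_def)
    then obtain e where e: "e \<in> carrier (middle X)" "proj_map X e = proj_map Y y"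
      by auto
    have "proj_map Y (y \<otimes>\<^bsub>middle Y\<^esub> inv\<^bsub>middle Y\<^esub> f e) = \<one>\<^bsub>\<Gamma>\<^esub>"
      using y e proj by simp
    then obtain m where m: "m \<in> carrier M" "y \<otimes>\<^bsub>middle Y\<^esub> inv\<^bsub>middle Y\<^esub> f e = inj_map Y m"
      using Y.proj_eq_oneE[of "y \<otimes>\<^bsub>middle Y\<^esub> inv\<^bsub>middle Y\<^esub> f e"] y e(1) by auto
    have "y = (y \<otimes>\<^bsub>middle Y\<^esub> inv\<^bsub>middle Y\<^esub> f e) \<otimes>\<^bsub>middle Y\<^esub> f e"
      using y e(1) by (simp add: Y.middle.m_assoc)
    also have "\<dots> = f (inj_map X m \<otimes>\<^bsub>middle X\<^esub> e)"
      unfolding m(2) using m(1) e(1) by (simp add: inj)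
    finally have "y = f (inj_map X m \<otimes>\<^bsub>middle X\<^esub> e)" .
    moreover have "inj_map X m \<otimes>\<^bsub>middle X\<^esub> e \<in> carrier (middle X)"
      using m(1) e(1) by simp
    ultimately show "y \<in> f ` carrier (middle X)"
      by (rule image_eqI)
  qed
  ultimately show ?thesis
    using f by (auto simp: iso_def bij_betw_def)
qed

text \<open>
  The extension axioms are invariant under isomorphism. This gives the exactness and the conjugation
  law for the amalgamated extension without computing with cosets.
\<close>

lemma group_extension_transfer:
  assumes "group_extension \<Gamma> M act X" and "group (middle Y)"
    and \<theta>: "\<theta> \<in> iso (middle Y) (middle X)"
    and closed: "\<And>m. m \<in> carrier M \<Longrightarrow> inj_map Y m \<in> carrier (middle Y)"
    and inj: "\<And>m. m \<in> carrier M \<Longrightarrow> \<theta> (inj_map Y m) = inj_map X m"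
    and proj: "\<And>e. e \<in> carrier (middle Y) \<Longrightarrow> proj_map X (\<theta> e) = proj_map Y e"
  shows "group_extension \<Gamma> M act Y"
proof -
  interpret X: group_extension \<Gamma> M act X by fact
  interpret Y: group "middle Y" by fact
  interpret \<theta>: group_hom "middle Y" "middle X" \<theta>
    using \<theta> by unfold_locales (simp add: iso_def)
  have eqI: "a = b" if "a \<in> carrier (middle Y)" "b \<in> carrier (middle Y)" "\<theta> a = \<theta> b" for a b
    using \<theta> that by (auto simp: iso_def bij_betw_def inj_on_def)
  have onto: "\<theta> ` carrier (middle Y) = carrier (middle X)"
    using \<theta> by (auto simp: iso_def bij_betw_def)
  show ?thesis
  proof (intro group_extension.intro group_extension_axioms.intro X.group_module_axioms)
    show "group (middle Y)" by fact
    have "inj_map Y \<in> hom M (middle Y)"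
    proof (rule homI)
      fix m m' assume "m \<in> carrier M" "m' \<in> carrier M"
      then show "inj_map Y (m \<otimes>\<^bsub>M\<^esub> m') = inj_map Y m \<otimes>\<^bsub>middle Y\<^esub> inj_map Y m'"
        using closed by (intro eqI) (simp_all add: inj)
    qed (rule closed)
    moreover have "inj_on (inj_map Y) (carrier M)"
      by (rule inj_onI) (metis inj X.inj_map_inject)
    ultimately show "inj_map Y \<in> mon M (middle Y)"
      by (simp add: mon_def)
    have "proj_map Y \<in> hom (middle Y) \<Gamma>"
      by (rule homI) (simp_all flip: proj)
    moreover have "proj_map Y ` carrier (middle Y) = proj_map X ` (\<theta> ` carrier (middle Y))"
      unfolding image_image by (rule image_cong) (simp_all add: proj)
    ultimately show "proj_map Y \<in> epi (middle Y) \<Gamma>"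
      using onto X.proj_map_epi by (simp add: epi_def)
    show "inj_map Y ` carrier M = kernel (middle Y) \<Gamma> (proj_map Y)"
    proof (intro equalityI subsetI)
      fix y assume "y \<in> inj_map Y ` carrier M"
      then obtain m where "m \<in> carrier M" "y = inj_map Y m" by blast
      then show "y \<in> kernel (middle Y) \<Gamma> (proj_map Y)"
        using closed X.proj_inj by (simp add: kernel_def inj flip: proj)
    next
      fix y assume "y \<in> kernel (middle Y) \<Gamma> (proj_map Y)"
      then have y: "y \<in> carrier (middle Y)" and "proj_map X (\<theta> y) = \<one>\<^bsub>\<Gamma>\<^esub>"
        by (auto simp: kernel_def proj)
      then obtain m where "m \<in> carrier M" "\<theta> y = inj_map X m"
        using X.proj_eq_oneE by (metis \<theta>.hom_closed)
      then show "y \<in> inj_map Y ` carrier M"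
        using y closed inj eqI by (metis image_eqI)
    qed
    fix e m assume "e \<in> carrier (middle Y)" "m \<in> carrier M"
    moreover have "act g m \<in> carrier M" if "g \<in> carrier \<Gamma>" "m \<in> carrier M" for g m
      using X.act_automorphism that by blast
    ultimately show "e \<otimes>\<^bsub>middle Y\<^esub> inj_map Y m \<otimes>\<^bsub>middle Y\<^esub> inv\<^bsub>middle Y\<^esub> e
        = inj_map Y (act (proj_map Y e) m)"
      using closed by (intro eqI) (simp_all add: inj X.conj_act flip: proj)
  qed
qed

lemma congruent_ext_sym:
  assumes "congruent_ext \<Gamma> M act X Y"
  shows "congruent_ext \<Gamma> M act Y X"
proof -
  obtain f where X: "group_extension \<Gamma> M act X" and Y: "group_extension \<Gamma> M act Y"
    and f: "f \<in> hom (middle X) (middle Y)"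
    and inj: "\<And>m. m \<in> carrier M \<Longrightarrow> f (inj_map X m) = inj_map Y m"
    and proj: "\<And>e. e \<in> carrier (middle X) \<Longrightarrow> proj_map Y (f e) = proj_map X e"
    using assms by (auto simp: congruent_ext_def)
  interpret X: group_extension \<Gamma> M act X by fact
  have iso: "f \<in> iso (middle X) (middle Y)"
    by (rule congruence_iso[OF X Y f inj proj])
  define g where "g = inv_into (carrier (middle X)) f"
  have bij: "bij_betw f (carrier (middle X)) (carrier (middle Y))"
    using iso by (simp add: iso_def)
  have "g \<in> hom (middle Y) (middle X)"
    using X.middle.iso_set_sym[OF iso] by (simp add: g_def iso_def)
  moreover have "g (inj_map Y m) = inj_map X m" if "m \<in> carrier M" for m
    using bij that by (simp add: g_def bij_betw_inv_into_left flip: inj)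
  moreover have "proj_map X (g y) = proj_map Y y" if "y \<in> carrier (middle Y)" for y
  proof -
    have "g y \<in> carrier (middle X)" "f (g y) = y"
      using bij that by (auto simp: g_def bij_betw_inv_into_right bij_betw_apply[OF bij_betw_inv_into])
    then show ?thesis using proj by metis
  qed
  ultimately show ?thesis
    using X Y by (auto simp: congruent_ext_def)
qed

lemma congruent_ext_trans:
  assumes XY: "congruent_ext \<Gamma> M act X Y" and YZ: "congruent_ext \<Gamma> M act Y Z"
  shows "congruent_ext \<Gamma> M act X Z"
proof -
  obtain f where f: "f \<in> hom (middle X) (middle Y)"
    "\<And>m. m \<in> carrier M \<Longrightarrow> f (inj_map X m) = inj_map Y m"
    "\<And>e. e \<in> carrier (middle X) \<Longrightarrow> proj_map Y (f e) = proj_map X e"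
    using XY by (auto simp: congruent_ext_def)
  obtain g where g: "g \<in> hom (middle Y) (middle Z)"
    "\<And>m. m \<in> carrier M \<Longrightarrow> g (inj_map Y m) = inj_map Z m"
    "\<And>e. e \<in> carrier (middle Y) \<Longrightarrow> proj_map Z (g e) = proj_map Y e"
    using YZ by (auto simp: congruent_ext_def)
  have "f e \<in> carrier (middle Y)" if "e \<in> carrier (middle X)" for e
    using f(1) that by (auto simp: hom_def)
  with f g have "g \<circ> f \<in> hom (middle X) (middle Z)"
    "\<forall>m\<in>carrier M. (g \<circ> f) (inj_map X m) = inj_map Z m"
    "\<forall>e\<in>carrier (middle X). proj_map Z ((g \<circ> f) e) = proj_map X e"
    by (auto intro: Group.hom_compose)
  then show ?thesis
    using XY YZ unfolding congruent_ext_def by blast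
qed

section \<open>Restriction to a subgroup\<close>

lemma restrict_ext_simps [simp]:
  "inj_map (restrict_ext X S) = inj_map X"
  "proj_map (restrict_ext X S) = proj_map X"
  "middle (restrict_ext X S) = (middle X)\<lparr>carrier := {e \<in> carrier (middle X). proj_map X e \<in> S}\<rparr>"
  by (simp_all add: restrict_ext_def)

lemma (in group_extension) subgroup_proj_vimage:
  assumes "subgroup S \<Gamma>"
  shows "subgroup {e \<in> carrier (middle X). proj_map X e \<in> S} (middle X)"
  using assms by (intro middle.subgroupI) (auto simp: subgroup_def)

lemma (in group_extension) group_extension_restrict:
  assumes S: "subgroup S \<Gamma>"
  shows "group_extension (\<Gamma>\<lparr>carrier := S\<rparr>) M act (restrict_ext X S)"
proof -
  note E = subgroup_proj_vimage[OF S]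
  note S' = subgroup.mem_carrier[OF S] subgroup.one_closed[OF S]
  interpret S: group "\<Gamma>\<lparr>carrier := S\<rparr>"
    using S by (rule subgroup.subgroup_is_group) unfold_locales
  have "act \<in> hom (\<Gamma>\<lparr>carrier := S\<rparr>) (AutoGroup M)"
    using act_hom S' by (auto simp: hom_def)
  then have "group_module (\<Gamma>\<lparr>carrier := S\<rparr>) M act"
    by unfold_locales
  then show ?thesis
  proof (intro group_extension.intro group_extension_axioms.intro)
    show "group (middle (restrict_ext X S))"
      using E by (auto intro: subgroup.subgroup_is_group)
    have "inj_map X \<in> hom M ((middle X)\<lparr>carrier := {e \<in> carrier (middle X). proj_map X e \<in> S}\<rparr>)"
      by (rule homI) (simp_all add: proj_inj S')
    then show "inj_map (restrict_ext X S) \<in> mon M (middle (restrict_ext X S))"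
      using inj_map_mon by (simp add: mon_def)
    have "proj_map X ` {e \<in> carrier (middle X). proj_map X e \<in> S} = proj_map X ` carrier (middle X) \<inter> S"
      by blast
    also have "\<dots> = S"
      using proj_map_epi S'(1) by (auto simp: epi_def)
    finally show "proj_map (restrict_ext X S) \<in> epi (middle (restrict_ext X S)) (\<Gamma>\<lparr>carrier := S\<rparr>)"
      by (simp add: epi_def hom_def)
    show "inj_map (restrict_ext X S) ` carrier M
        = kernel (middle (restrict_ext X S)) (\<Gamma>\<lparr>carrier := S\<rparr>) (proj_map (restrict_ext X S))"
      using S'(2) by (simp add: exact) (auto simp: kernel_def)
  next
    fix e m assume "e \<in> carrier (middle (restrict_ext X S))" "m \<in> carrier M"
    then show "e \<otimes>\<^bsub>middle (restrict_ext X S)\<^esub> inj_map (restrict_ext X S) m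
        \<otimes>\<^bsub>middle (restrict_ext X S)\<^esub> inv\<^bsub>middle (restrict_ext X S)\<^esub> e
      = inj_map (restrict_ext X S) (act (proj_map (restrict_ext X S) e) m)"
      using middle.m_inv_consistent[OF E] conj_act by simp
  qed
qed

lemma congruent_ext_restrict:
  assumes XY: "congruent_ext \<Gamma> M act X Y" and S: "subgroup S \<Gamma>"
  shows "congruent_ext (\<Gamma>\<lparr>carrier := S\<rparr>) M act (restrict_ext X S) (restrict_ext Y S)"
proof -
  obtain f where "group_extension \<Gamma> M act X" and "group_extension \<Gamma> M act Y"
    and f: "f \<in> hom (middle X) (middle Y)"
    and inj: "\<forall>m\<in>carrier M. f (inj_map X m) = inj_map Y m"
    and proj: "\<forall>e\<in>carrier (middle X). proj_map Y (f e) = proj_map X e"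
    using XY by (auto simp: congruent_ext_def)
  moreover have "f \<in> hom (middle (restrict_ext X S)) (middle (restrict_ext Y S))"
    using f proj by (auto simp: hom_def)
  ultimately show ?thesis
    using inj proj by (auto simp: congruent_ext_def group_extension.group_extension_restrict[OF _ S])
qed

text \<open>
  A lift \<open>j\<close> of the inclusion of \<open>S\<close> into \<open>\<Gamma>\<close> that is the identity on \<open>M\<close> lands over \<open>S\<close>, so it is
  already a congruence onto the restricted extension; by the five lemma it identifies the middle
  group of \<open>A\<close> with the whole preimage of \<open>S\<close>. Both maps of a realization are lifts of this kind.
\<close>

lemma congruent_ext_restrict_of_lift:
  assumes A: "group_extension (\<Gamma>\<lparr>carrier := S\<rparr>) M act A" and X: "group_extension \<Gamma> M act X"
    and S: "subgroup S \<Gamma>"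
    and j: "j \<in> hom (middle A) (middle X)"
    and inj: "\<And>m. m \<in> carrier M \<Longrightarrow> j (inj_map A m) = inj_map X m"
    and proj: "\<And>a. a \<in> carrier (middle A) \<Longrightarrow> proj_map X (j a) = proj_map A a"
  shows "congruent_ext (\<Gamma>\<lparr>carrier := S\<rparr>) M act A (restrict_ext X S)"
    and "j \<in> iso (middle A) (middle (restrict_ext X S))"
proof -
  interpret A: group_extension "\<Gamma>\<lparr>carrier := S\<rparr>" M act A by fact
  have XS: "group_extension (\<Gamma>\<lparr>carrier := S\<rparr>) M act (restrict_ext X S)"
    using X S by (rule group_extension.group_extension_restrict)
  have "proj_map A a \<in> S" if "a \<in> carrier (middle A)" for a
    using A.proj.hom_closed[OF that] by simp
  then have j': "j \<in> hom (middle A) (middle (restrict_ext X S))"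
    using j proj by (auto simp: hom_def)
  then show "congruent_ext (\<Gamma>\<lparr>carrier := S\<rparr>) M act A (restrict_ext X S)"
    using A XS inj proj by (auto simp: congruent_ext_def)
  show "j \<in> iso (middle A) (middle (restrict_ext X S))"
    using congruence_iso[OF A XS j'] inj proj by simp
qed

section \<open>The amalgamated extension of a realized triple\<close>

text \<open>
  The realizing extension \<open>X\<close> and the maps \<open>i\<^sub>1\<close>, \<open>i\<^sub>2\<close> are parameters, so that part (b) can name them:
  there the congruence must hold with one particular extension.
\<close>

locale realized_triple =
  X: group_extension G M act X +
  A: group_extension "G\<lparr>carrier := N\<rparr>" M act A +
  B: group_extension "G\<lparr>carrier := T\<rparr>" M act B
  for G :: "'g monoid" and M :: "'m monoid" and act :: "'g \<Rightarrow> 'm \<Rightarrow> 'm"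
    and X :: "('m, 'e, 'g) ext_data"
    and N :: "'g set" and A :: "('m, 'n, 'g) ext_data"
    and T :: "'g set" and B :: "('m, 't, 'g) ext_data" +
  fixes \<phi> :: "'t \<Rightarrow> 'n \<Rightarrow> 'n" and i\<^sub>1 :: "'n \<Rightarrow> 'e" and i\<^sub>2 :: "'t \<Rightarrow> 'e"
  assumes normal_N: "normal N G" and subgroup_T: "subgroup T G"
    and inter: "N \<inter> T = {\<one>\<^bsub>G\<^esub>}" and product: "N <#>\<^bsub>G\<^esub> T = carrier G"
    and i\<^sub>1_hom: "i\<^sub>1 \<in> hom (middle A) (middle X)"
    and i\<^sub>2_hom: "i\<^sub>2 \<in> hom (middle B) (middle X)"
    and i\<^sub>1_inj_map: "\<And>m. m \<in> carrier M \<Longrightarrow> i\<^sub>1 (inj_map A m) = inj_map X m"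
    and i\<^sub>2_inj_map: "\<And>m. m \<in> carrier M \<Longrightarrow> i\<^sub>2 (inj_map B m) = inj_map X m"
    and proj_i\<^sub>1: "\<And>a. a \<in> carrier (middle A) \<Longrightarrow> proj_map X (i\<^sub>1 a) = proj_map A a"
    and proj_i\<^sub>2: "\<And>b. b \<in> carrier (middle B) \<Longrightarrow> proj_map X (i\<^sub>2 b) = proj_map B b"
    and \<phi>_eq: "\<And>b a. \<lbrakk>b \<in> carrier (middle B); a \<in> carrier (middle A)\<rbrakk> \<Longrightarrow>
      \<phi> b a = inv_into (carrier (middle A)) i\<^sub>1
                (i\<^sub>2 b \<otimes>\<^bsub>middle X\<^esub> i\<^sub>1 a \<otimes>\<^bsub>middle X\<^esub> inv\<^bsub>middle X\<^esub> (i\<^sub>2 b))"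
begin

sublocale i\<^sub>1: group_hom "middle A" "middle X" i\<^sub>1
  using i\<^sub>1_hom by unfold_locales

sublocale i\<^sub>2: group_hom "middle B" "middle X" i\<^sub>2
  using i\<^sub>2_hom by unfold_locales

lemma subgroup_N: "subgroup N G"
  using normal_N by (rule normal_imp_subgroup)

lemma restrict_congruent:
  shows "congruent_ext (G\<lparr>carrier := N\<rparr>) M act A (restrict_ext X N)"
    and "congruent_ext (G\<lparr>carrier := T\<rparr>) M act B (restrict_ext X T)"
  using congruent_ext_restrict_of_lift(1)[OF A.group_extension_axioms X.group_extension_axioms
      subgroup_N i\<^sub>1_hom i\<^sub>1_inj_map proj_i\<^sub>1]
    congruent_ext_restrict_of_lift(1)[OF B.group_extension_axioms X.group_extension_axioms
      subgroup_T i\<^sub>2_hom i\<^sub>2_inj_map proj_i\<^sub>2]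
  by blast+

lemma i\<^sub>1_bij: "bij_betw i\<^sub>1 (carrier (middle A)) {e \<in> carrier (middle X). proj_map X e \<in> N}"
  using congruent_ext_restrict_of_lift(2)[OF A.group_extension_axioms X.group_extension_axioms
      subgroup_N i\<^sub>1_hom i\<^sub>1_inj_map proj_i\<^sub>1]
  by (simp add: iso_def)

lemma i\<^sub>1_eqD:
  "\<lbrakk>i\<^sub>1 a = i\<^sub>1 a'; a \<in> carrier (middle A); a' \<in> carrier (middle A)\<rbrakk> \<Longrightarrow> a = a'"
  using i\<^sub>1_bij by (auto simp: bij_betw_def dest: inj_onD)

lemma i\<^sub>2_bij: "bij_betw i\<^sub>2 (carrier (middle B)) {e \<in> carrier (middle X). proj_map X e \<in> T}"
  using congruent_ext_restrict_of_lift(2)[OF B.group_extension_axioms X.group_extension_axioms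
      subgroup_T i\<^sub>2_hom i\<^sub>2_inj_map proj_i\<^sub>2]
  by (simp add: iso_def)

text \<open>
  The conjugate of \<open>i\<^sub>1 a\<close> still lies over \<open>N\<close>, by normality, and \<open>i\<^sub>1\<close> maps onto everything over \<open>N\<close>.
  So the inverse image defining \<open>\<phi> b a\<close> is taken at a point of the range of \<open>i\<^sub>1\<close>. The laws of \<open>\<phi>\<close>
  then reduce, along the injective \<open>i\<^sub>1\<close>, to those of conjugation in the middle group of \<open>X\<close>.
\<close>

lemma
  assumes b: "b \<in> carrier (middle B)" and a: "a \<in> carrier (middle A)"
  shows \<phi>_closed: "\<phi> b a \<in> carrier (middle A)"
    and i\<^sub>1_\<phi>: "i\<^sub>1 (\<phi> b a) = i\<^sub>2 b \<otimes>\<^bsub>middle X\<^esub> i\<^sub>1 a \<otimes>\<^bsub>middle X\<^esub> inv\<^bsub>middle X\<^esub> (i\<^sub>2 b)"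
proof -
  let ?e = "i\<^sub>2 b \<otimes>\<^bsub>middle X\<^esub> i\<^sub>1 a \<otimes>\<^bsub>middle X\<^esub> inv\<^bsub>middle X\<^esub> (i\<^sub>2 b)"
  have "proj_map A a \<in> N" and "proj_map B b \<in> T"
    using A.proj.hom_closed[OF a] B.proj.hom_closed[OF b] by simp_all
  then have "proj_map B b \<otimes>\<^bsub>G\<^esub> proj_map A a \<otimes>\<^bsub>G\<^esub> inv\<^bsub>G\<^esub> proj_map B b \<in> N"
    using normal.inv_op_closed2[OF normal_N] subgroup.mem_carrier[OF subgroup_T] by blast
  then have "proj_map X ?e \<in> N"
    using a b by (simp add: proj_i\<^sub>1 proj_i\<^sub>2)
  moreover have "?e \<in> carrier (middle X)"
    using a b by simp
  ultimately have e: "?e \<in> i\<^sub>1 ` carrier (middle A)"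
    using i\<^sub>1_bij by (simp add: bij_betw_def)
  show "\<phi> b a \<in> carrier (middle A)"
    unfolding \<phi>_eq[OF b a] using e by (rule inv_into_into)
  show "i\<^sub>1 (\<phi> b a) = ?e"
    unfolding \<phi>_eq[OF b a] using e by (rule f_inv_into_f)
qed

lemma \<phi>_mult:
  assumes "b \<in> carrier (middle B)" "a \<in> carrier (middle A)" "a' \<in> carrier (middle A)"
  shows "\<phi> b (a \<otimes>\<^bsub>middle A\<^esub> a') = \<phi> b a \<otimes>\<^bsub>middle A\<^esub> \<phi> b a'"
  by (rule i\<^sub>1_eqD) (use assms in \<open>simp_all add: \<phi>_closed i\<^sub>1_\<phi> X.middle.m_assoc X.middle.inv_mult_cancel_left\<close>)

lemma \<phi>_compose:
  assumes "b \<in> carrier (middle B)" "b' \<in> carrier (middle B)" "a \<in> carrier (middle A)"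
  shows "\<phi> (b \<otimes>\<^bsub>middle B\<^esub> b') a = \<phi> b (\<phi> b' a)"
  by (rule i\<^sub>1_eqD)
    (use assms in \<open>simp_all add: \<phi>_closed i\<^sub>1_\<phi> X.middle.m_assoc X.middle.inv_mult_group\<close>)

lemma \<phi>_one: "a \<in> carrier (middle A) \<Longrightarrow> \<phi> \<one>\<^bsub>middle B\<^esub> a = a"
  by (rule i\<^sub>1_eqD) (simp_all add: \<phi>_closed i\<^sub>1_\<phi>)

abbreviation S :: "('n \<times> 't) monoid"
  where "S \<equiv> semidirect_prod (middle A) (middle B) \<phi>"

lemma carrier_S: "carrier S = carrier (middle A) \<times> carrier (middle B)"
  and mult_S: "(a, b) \<otimes>\<^bsub>S\<^esub> (a', b') = (a \<otimes>\<^bsub>middle A\<^esub> \<phi> b a', b \<otimes>\<^bsub>middle B\<^esub> b')"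
  and one_S: "\<one>\<^bsub>S\<^esub> = (\<one>\<^bsub>middle A\<^esub>, \<one>\<^bsub>middle B\<^esub>)"
  by (simp_all add: semidirect_prod_def)

lemma group_S: "group S"
proof (rule groupI)
  fix x y assume "x \<in> carrier S" "y \<in> carrier S"
  then show "x \<otimes>\<^bsub>S\<^esub> y \<in> carrier S"
    by (cases x; cases y) (simp add: carrier_S mult_S \<phi>_closed)
next
  show "\<one>\<^bsub>S\<^esub> \<in> carrier S"
    by (simp add: carrier_S one_S)
next
  fix x y z assume "x \<in> carrier S" "y \<in> carrier S" "z \<in> carrier S"
  then show "x \<otimes>\<^bsub>S\<^esub> y \<otimes>\<^bsub>S\<^esub> z = x \<otimes>\<^bsub>S\<^esub> (y \<otimes>\<^bsub>S\<^esub> z)"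
    by (cases x; cases y; cases z)
      (simp add: carrier_S mult_S \<phi>_closed \<phi>_mult \<phi>_compose A.middle.m_assoc B.middle.m_assoc)
next
  fix x assume "x \<in> carrier S"
  then show "\<one>\<^bsub>S\<^esub> \<otimes>\<^bsub>S\<^esub> x = x"
    by (cases x) (simp add: carrier_S mult_S one_S \<phi>_one)
next
  fix x assume x: "x \<in> carrier S"
  obtain a b where ab: "x = (a, b)" by (cases x)
  \<comment> \<open>inverting \<open>(a, b)\<close> inverts \<open>b\<close> and moves the inverse of \<open>a\<close> past it\<close>
  let ?y = "(\<phi> (inv\<^bsub>middle B\<^esub> b) (inv\<^bsub>middle A\<^esub> a), inv\<^bsub>middle B\<^esub> b)"
  have 1: "\<phi> b \<one>\<^bsub>middle A\<^esub> = \<one>\<^bsub>middle A\<^esub>" if "b \<in> carrier (middle B)" for b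
    by (rule i\<^sub>1_eqD) (use that in \<open>simp_all add: \<phi>_closed i\<^sub>1_\<phi>\<close>)
  have "?y \<in> carrier S" and "?y \<otimes>\<^bsub>S\<^esub> x = \<one>\<^bsub>S\<^esub>"
    using x by (simp_all add: ab carrier_S mult_S one_S \<phi>_closed 1 flip: \<phi>_mult)
  then show "\<exists>y\<in>carrier S. y \<otimes>\<^bsub>S\<^esub> x = \<one>\<^bsub>S\<^esub>" by blast
qed

definition \<Phi> :: "'n \<times> 't \<Rightarrow> 'e"
  where "\<Phi> = (\<lambda>(a, b). i\<^sub>1 a \<otimes>\<^bsub>middle X\<^esub> i\<^sub>2 b)"

sublocale \<Phi>: group_hom S "middle X" \<Phi>
proof (intro group_hom.intro group_hom_axioms.intro group_S X.group_middle homI)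
  fix x y assume "x \<in> carrier S" "y \<in> carrier S"
  then show "\<Phi> (x \<otimes>\<^bsub>S\<^esub> y) = \<Phi> x \<otimes>\<^bsub>middle X\<^esub> \<Phi> y"
    by (cases x; cases y) (simp add: \<Phi>_def carrier_S mult_S \<phi>_closed i\<^sub>1_\<phi> X.middle.m_assoc
        X.middle.inv_mult_cancel_left)
qed (auto simp: \<Phi>_def carrier_S)

lemma proj_\<Phi>:
  "x \<in> carrier S \<Longrightarrow> proj_map X (\<Phi> x) = (case x of (a, b) \<Rightarrow> proj_map A a \<otimes>\<^bsub>G\<^esub> proj_map B b)"
  by (cases x) (simp add: \<Phi>_def carrier_S proj_i\<^sub>1 proj_i\<^sub>2)

text \<open>
  Write the projection of \<open>e\<close> as \<open>n t\<close> and lift \<open>t\<close> to some \<open>b\<close>; dividing \<open>e\<close> by \<open>i\<^sub>2 b\<close> leaves an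
  element over \<open>n\<close>, which \<open>i\<^sub>1\<close> reaches.
\<close>

lemma \<Phi>_onto: "\<Phi> ` carrier S = carrier (middle X)"
proof
  show "\<Phi> ` carrier S \<subseteq> carrier (middle X)" by auto
  show "carrier (middle X) \<subseteq> \<Phi> ` carrier S"
  proof
    fix e assume e: "e \<in> carrier (middle X)"
    have "proj_map X e \<in> N <#>\<^bsub>G\<^esub> T"
      unfolding product using e by simp
    then obtain n t where n: "n \<in> N" and t: "t \<in> T" and nt: "proj_map X e = n \<otimes>\<^bsub>G\<^esub> t"
      by (auto simp: set_mult_def)
    have G: "n \<in> carrier G" "t \<in> carrier G"
      using n t subgroup.mem_carrier[OF subgroup_N] subgroup.mem_carrier[OF subgroup_T] by auto
    have "t \<in> proj_map B ` carrier (middle B)"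
      using t B.proj_map_epi by (simp add: epi_def)
    then obtain b where b: "b \<in> carrier (middle B)" "proj_map B b = t"
      by blast
    let ?e = "e \<otimes>\<^bsub>middle X\<^esub> inv\<^bsub>middle X\<^esub> i\<^sub>2 b"
    have "proj_map X ?e = n \<otimes>\<^bsub>G\<^esub> t \<otimes>\<^bsub>G\<^esub> inv\<^bsub>G\<^esub> t"
      using e b by (simp add: proj_i\<^sub>2 nt)
    also have "\<dots> = n"
      using G by (simp add: X.\<Gamma>.m_assoc)
    finally have "?e \<in> i\<^sub>1 ` carrier (middle A)"
      using i\<^sub>1_bij n e b by (simp add: bij_betw_def)
    then obtain a where a: "a \<in> carrier (middle A)" "?e = i\<^sub>1 a"
      by blast
    have "e = ?e \<otimes>\<^bsub>middle X\<^esub> i\<^sub>2 b"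
      using e b by (simp add: X.middle.m_assoc)
    then have "e = \<Phi> (a, b)"
      by (simp add: \<Phi>_def a)
    then show "e \<in> \<Phi> ` carrier S"
      using a(1) b(1) by (auto simp: carrier_S)
  qed
qed

text \<open>
  If \<open>i\<^sub>1 a \<cdot> i\<^sub>2 b = 1\<close>, then \<open>a\<close> projects into both \<open>N\<close> and \<open>T\<close>, hence to \<open>1\<close>, and \<open>a\<close> comes from
  some \<open>m\<close> in \<open>M\<close>. Then \<open>b\<close> is determined, because \<open>i\<^sub>2\<close> is injective and agrees with \<open>i\<^sub>1\<close> on \<open>M\<close>.
\<close>

lemma kernel_\<Phi>:
  "kernel S (middle X) \<Phi> = {(inj_map A m, inv\<^bsub>middle B\<^esub> (inj_map B m)) | m. m \<in> carrier M}"
    (is "_ = ?K")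
proof (intro equalityI subsetI)
  fix x assume "x \<in> ?K"
  then show "x \<in> kernel S (middle X) \<Phi>"
    by (auto simp: kernel_def carrier_S \<Phi>_def i\<^sub>1_inj_map i\<^sub>2_inj_map)
next
  fix x assume "x \<in> kernel S (middle X) \<Phi>"
  then obtain a b where x: "x = (a, b)" and a: "a \<in> carrier (middle A)"
    and b: "b \<in> carrier (middle B)" and ab: "i\<^sub>1 a \<otimes>\<^bsub>middle X\<^esub> i\<^sub>2 b = \<one>\<^bsub>middle X\<^esub>"
    by (cases x) (auto simp: kernel_def carrier_S \<Phi>_def)
  have N: "proj_map A a \<in> N" and T: "proj_map B b \<in> T"
    using A.proj.hom_closed[OF a] B.proj.hom_closed[OF b] by simp_all
  have G: "proj_map A a \<in> carrier G" "proj_map B b \<in> carrier G"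
    using N T subgroup.mem_carrier[OF subgroup_N] subgroup.mem_carrier[OF subgroup_T] by auto
  have "proj_map A a \<otimes>\<^bsub>G\<^esub> proj_map B b = proj_map X (i\<^sub>1 a \<otimes>\<^bsub>middle X\<^esub> i\<^sub>2 b)"
    using a b by (simp add: proj_i\<^sub>1 proj_i\<^sub>2)
  also have "\<dots> = \<one>\<^bsub>G\<^esub>"
    by (simp add: ab)
  finally have "inv\<^bsub>G\<^esub> proj_map B b = proj_map A a"
    using G by (intro X.\<Gamma>.inv_equality)
  then have "proj_map A a \<in> N \<inter> T"
    using N subgroup.m_inv_closed[OF subgroup_T T] by simp
  then have "proj_map A a = \<one>\<^bsub>G\<^esub>"
    unfolding inter by simp
  then obtain m where m: "m \<in> carrier M" "a = inj_map A m"
    using A.proj_eq_oneE[OF a] by auto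
  have "i\<^sub>2 b = inv\<^bsub>middle X\<^esub> (i\<^sub>1 a)"
    using a b ab X.middle.inv_equality X.middle.inv_comm by (metis i\<^sub>1.hom_closed i\<^sub>2.hom_closed)
  also have "\<dots> = i\<^sub>2 (inv\<^bsub>middle B\<^esub> inj_map B m)"
    using m by (simp add: i\<^sub>1_inj_map i\<^sub>2_inj_map)
  finally have "b = inv\<^bsub>middle B\<^esub> inj_map B m"
    using i\<^sub>2_bij b m(1) by (intro inj_onD[of i\<^sub>2 "carrier (middle B)"]) (simp_all add: bij_betw_def)
  then show "x \<in> ?K"
    using x m by blast
qed

lemma \<Phi>_image_coset:
  assumes "x \<in> carrier S"
  shows "\<Phi> ` (kernel S (middle X) \<Phi> #>\<^bsub>S\<^esub> x) = {\<Phi> x}"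
proof -
  have "\<Phi> (k \<otimes>\<^bsub>S\<^esub> x) = \<Phi> x" if "k \<in> kernel S (middle X) \<Phi>" for k
    using that assms by (simp add: kernel_def)
  moreover have "\<one>\<^bsub>S\<^esub> \<in> kernel S (middle X) \<Phi>"
    by (rule subgroup.one_closed[OF \<Phi>.subgroup_kernel])
  ultimately show ?thesis
    unfolding r_coset_def by (simp add: image_UN) blast
qed

abbreviation Y :: "('m, ('n \<times> 't) set, 'g) ext_data"
  where "Y \<equiv> amalgamated_ext G M A B \<phi>"

lemma middle_Y: "middle Y = S Mod kernel S (middle X) \<Phi>"
  by (simp add: amalgamated_ext_def Let_def kernel_\<Phi>)

lemma inj_map_Y: "inj_map Y m = kernel S (middle X) \<Phi> #>\<^bsub>S\<^esub> (inj_map A m, \<one>\<^bsub>middle B\<^esub>)"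
  by (simp add: amalgamated_ext_def Let_def kernel_\<Phi>)

lemma proj_map_Y:
  assumes "x \<in> carrier S"
  shows "proj_map Y (kernel S (middle X) \<Phi> #>\<^bsub>S\<^esub> x) = proj_map X (\<Phi> x)"
proof -
  let ?C = "kernel S (middle X) \<Phi> #>\<^bsub>S\<^esub> x"
  have "?C \<subseteq> carrier S"
    using assms subgroup.subset[OF \<Phi>.subgroup_kernel] by (rule \<Phi>.G.r_coset_subset_G[rotated])
  then have "(\<lambda>(a, b). proj_map A a \<otimes>\<^bsub>G\<^esub> proj_map B b) ` ?C = (\<lambda>x. proj_map X (\<Phi> x)) ` ?C"
    by (intro image_cong refl) (simp add: proj_\<Phi> subset_eq)
  also have "\<dots> = proj_map X ` \<Phi> ` ?C"
    by (simp add: image_image)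
  also have "\<dots> = {proj_map X (\<Phi> x)}"
    by (simp add: \<Phi>_image_coset[OF assms])
  finally show ?thesis
    by (simp add: amalgamated_ext_def Let_def kernel_\<Phi>)
qed

lemma amalgamated_ext_congruent: "congruent_ext G M act Y X"
proof -
  let ?\<theta> = "\<lambda>C. the_elem (\<Phi> ` C)"
  have iso: "?\<theta> \<in> iso (middle Y) (middle X)"
    unfolding middle_Y by (rule \<Phi>.FactGroup_iso_set[OF \<Phi>_onto])
  have group: "group (middle Y)"
    unfolding middle_Y by (rule normal.factorgroup_is_group[OF \<Phi>.normal_kernel])
  have mem: "(inj_map A m, \<one>\<^bsub>middle B\<^esub>) \<in> carrier S" if "m \<in> carrier M" for m
    using that by (simp add: carrier_S)
  have closed: "inj_map Y m \<in> carrier (middle Y)" if "m \<in> carrier M" for m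
    unfolding middle_Y inj_map_Y using mem[OF that] by (auto simp: FactGroup_def RCOSETS_def)
  have inj: "?\<theta> (inj_map Y m) = inj_map X m" if "m \<in> carrier M" for m
    unfolding inj_map_Y using that
    by (simp add: \<Phi>_image_coset[OF mem[OF that]]) (simp add: \<Phi>_def i\<^sub>1_inj_map)
  have proj: "proj_map X (?\<theta> C) = proj_map Y C" if "C \<in> carrier (middle Y)" for C
  proof -
    obtain x where "x \<in> carrier S" "C = kernel S (middle X) \<Phi> #>\<^bsub>S\<^esub> x"
      using \<open>C \<in> carrier (middle Y)\<close> unfolding middle_Y by (auto simp: FactGroup_def RCOSETS_def)
    then show ?thesis
      by (simp add: proj_map_Y \<Phi>_image_coset)
  qed
  have "group_extension G M act Y"
    by (rule group_extension_transfer[OF X.group_extension_axioms group iso closed inj proj])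
  then show ?thesis
    unfolding congruent_ext_def using iso inj proj X.group_extension_axioms
    by (intro conjI bexI[of _ ?\<theta>]) (auto simp: iso_def)
qed

end

section \<open>Realizable triples and the conjugation action\<close>

lemma realizableE:
  assumes "realizable TYPE('e) G M act A B \<phi>"
    and A: "group_extension (G\<lparr>carrier := N\<rparr>) M act A"
    and B: "group_extension (G\<lparr>carrier := T\<rparr>) M act B"
    and "normal N G" and "subgroup T G"
    and "N \<inter> T = {\<one>\<^bsub>G\<^esub>}" and "N <#>\<^bsub>G\<^esub> T = carrier G"
  obtains X :: "('m, 'e, 'g) ext_data" and i\<^sub>1 i\<^sub>2
    where "realized_triple G M act X N A T B \<phi> i\<^sub>1 i\<^sub>2"
proof -
  obtain X :: "('m, 'e, 'g) ext_data" and i\<^sub>1 i\<^sub>2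
    where X: "group_extension G M act X"
      and hom: "i\<^sub>1 \<in> hom (middle A) (middle X)" "i\<^sub>2 \<in> hom (middle B) (middle X)"
      and inj: "\<forall>m\<in>carrier M. i\<^sub>1 (inj_map A m) = inj_map X m \<and> inj_map X m = i\<^sub>2 (inj_map B m)"
      and proj: "\<forall>a\<in>carrier (middle A). proj_map X (i\<^sub>1 a) = proj_map A a"
        "\<forall>b\<in>carrier (middle B). proj_map X (i\<^sub>2 b) = proj_map B b"
      and \<phi>: "\<forall>b\<in>carrier (middle B). \<forall>a\<in>carrier (middle A).
        \<phi> b a = inv_into (carrier (middle A)) i\<^sub>1
          (i\<^sub>2 b \<otimes>\<^bsub>middle X\<^esub> i\<^sub>1 a \<otimes>\<^bsub>middle X\<^esub> inv\<^bsub>middle X\<^esub> (i\<^sub>2 b))"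
    using assms(1) unfolding realizable_def by blast
  have "realized_triple G M act X N A T B \<phi> i\<^sub>1 i\<^sub>2"
  proof (intro realized_triple.intro realized_triple_axioms.intro)
    fix m assume "m \<in> carrier M"
    then show "i\<^sub>1 (inj_map A m) = inj_map X m" and "i\<^sub>2 (inj_map B m) = inj_map X m"
      using inj by simp_all
  qed (fact X A B assms(4-7) hom | rule proj[THEN bspec] \<phi>[THEN bspec, THEN bspec], assumption+)+
  then show thesis
    by (rule that)
qed

context group_extension
begin

lemma proj_conj:
  assumes "normal N \<Gamma>"
    and b: "b \<in> carrier (middle X)" and a: "a \<in> carrier (middle X)" "proj_map X a \<in> N"
  shows "proj_map X (b \<otimes>\<^bsub>middle X\<^esub> a \<otimes>\<^bsub>middle X\<^esub> inv\<^bsub>middle X\<^esub> b) \<in> N"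
  using normal.inv_op_closed2[OF assms(1) proj.hom_closed[OF b] a(2)] a b by simp

text \<open>
  Conjugation by \<open>b\<close> preserves the image of \<open>M\<close> because there it is the action of the projection of
  \<open>b\<close>, which is an automorphism of \<open>M\<close>. Its inverse on the preimage of \<open>N\<close> is conjugation by the
  inverse of \<open>b\<close>.
\<close>

lemma conj_map_in_AutM:
  assumes N: "normal N \<Gamma>" and b: "b \<in> carrier (middle X)"
  shows "conj_map X N b \<in> carrier (AutM M (restrict_ext X N))"
proof -
  let ?P = "{e \<in> carrier (middle X). proj_map X e \<in> N}"
  let ?c = "conj_map X N b"
  note P = proj_conj[OF N]
  have c: "?c a = b \<otimes>\<^bsub>middle X\<^esub> a \<otimes>\<^bsub>middle X\<^esub> inv\<^bsub>middle X\<^esub> b" if "a \<in> ?P" for a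
    using that by (simp add: conj_map_def)
  have into: "?c a \<in> ?P" if "a \<in> ?P" for a
    unfolding c[OF that] using that b P by simp
  have hom: "?c (a \<otimes>\<^bsub>middle X\<^esub> a') = ?c a \<otimes>\<^bsub>middle X\<^esub> ?c a'" if "a \<in> ?P" "a' \<in> ?P" for a a'
  proof -
    have "a \<otimes>\<^bsub>middle X\<^esub> a' \<in> ?P"
      using that subgroup.m_closed[OF normal_imp_subgroup[OF N]] by simp
    then show ?thesis
      using that b by (simp add: c middle.m_assoc middle.inv_mult_cancel_left)
  qed
  have bij: "bij_betw ?c ?P ?P"
  proof (rule bij_betwI)
    show "?c \<in> ?P \<rightarrow> ?P" using into by blast
    show "(\<lambda>a. inv\<^bsub>middle X\<^esub> b \<otimes>\<^bsub>middle X\<^esub> a \<otimes>\<^bsub>middle X\<^esub> b) \<in> ?P \<rightarrow> ?P"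
      using P[of "inv\<^bsub>middle X\<^esub> b"] b by auto
  next
    fix a assume "a \<in> ?P"
    then show "inv\<^bsub>middle X\<^esub> b \<otimes>\<^bsub>middle X\<^esub> ?c a \<otimes>\<^bsub>middle X\<^esub> b = a"
      using b by (simp add: c middle.m_assoc middle.inv_mult_cancel_left)
  next
    fix a assume a: "a \<in> ?P"
    then have "inv\<^bsub>middle X\<^esub> b \<otimes>\<^bsub>middle X\<^esub> a \<otimes>\<^bsub>middle X\<^esub> b \<in> ?P"
      using P[of "inv\<^bsub>middle X\<^esub> b" a] b by simp
    then show "?c (inv\<^bsub>middle X\<^esub> b \<otimes>\<^bsub>middle X\<^esub> a \<otimes>\<^bsub>middle X\<^esub> b) = a"
      using a b middle.inv_mult_cancel_left[of "inv\<^bsub>middle X\<^esub> b"] by (simp add: c middle.m_assoc)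
  qed
  have "?c (inj_map X m) = inj_map X (act (proj_map X b) m)" if "m \<in> carrier M" for m
    using that b conj_act subgroup.one_closed[OF normal_imp_subgroup[OF N]]
    by (subst c) (simp_all add: proj_inj)
  then have "?c ` inj_map X ` carrier M = inj_map X ` act (proj_map X b) ` carrier M"
    unfolding image_image by (rule image_cong[OF refl])
  also have "\<dots> = inj_map X ` carrier M"
    using b by (simp add: act_automorphism)
  finally have "?c ` inj_map X ` carrier M = inj_map X ` carrier M" .
  moreover have "?c \<in> hom (middle (restrict_ext X N)) (middle (restrict_ext X N))"
    by (rule homI) (use into hom in simp_all)
  moreover have "?c \<in> extensional ?P"
    by (simp add: conj_map_def)
  ultimately show ?thesis
    using bij by (simp add: AutM_def auto_def Bij_def)
qed

lemma conj_map_hom: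
  assumes N: "normal N \<Gamma>"
  shows "conj_map X N \<in> hom (middle (restrict_ext X T)) (AutM M (restrict_ext X N))"
proof (rule homI)
  fix b assume "b \<in> carrier (middle (restrict_ext X T))"
  then show "conj_map X N b \<in> carrier (AutM M (restrict_ext X N))"
    using conj_map_in_AutM[OF N] by simp
next
  fix b b' assume "b \<in> carrier (middle (restrict_ext X T))" "b' \<in> carrier (middle (restrict_ext X T))"
  then have b: "b \<in> carrier (middle X)" "b' \<in> carrier (middle X)"
    by simp_all
  let ?P = "{e \<in> carrier (middle X). proj_map X e \<in> N}"
  have "conj_map X N (b \<otimes>\<^bsub>middle X\<^esub> b') = compose ?P (conj_map X N b) (conj_map X N b')"
    unfolding compose_def
    using b proj_conj[OF N]
    by (auto simp: conj_map_def fun_eq_iff middle.m_assoc middle.inv_mult_group)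
  moreover have "conj_map X N b \<in> Bij ?P" "conj_map X N b' \<in> Bij ?P"
    using b[THEN conj_map_in_AutM[OF N]] by (simp_all add: AutM_def auto_def)
  ultimately show "conj_map X N (b \<otimes>\<^bsub>middle (restrict_ext X T)\<^esub> b')
      = conj_map X N b \<otimes>\<^bsub>AutM M (restrict_ext X N)\<^esub> conj_map X N b'"
    by (simp add: AutM_def AutoGroup_def BijGroup_def)
qed

lemma inclusions_realize:
  assumes N: "normal N \<Gamma>" and T: "subgroup T \<Gamma>"
    and "N \<inter> T = {\<one>\<^bsub>\<Gamma>\<^esub>}" and "N <#>\<^bsub>\<Gamma>\<^esub> T = carrier \<Gamma>"
  shows "realized_triple \<Gamma> M act X N (restrict_ext X N) T (restrict_ext X T)
    (conj_map X N) (\<lambda>e. e) (\<lambda>e. e)"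
proof (intro realized_triple.intro realized_triple_axioms.intro)
  fix b a
  assume "b \<in> carrier (middle (restrict_ext X T))" "a \<in> carrier (middle (restrict_ext X N))"
  moreover from this
  have "b \<otimes>\<^bsub>middle X\<^esub> a \<otimes>\<^bsub>middle X\<^esub> inv\<^bsub>middle X\<^esub> b \<in> carrier (middle (restrict_ext X N))"
    using proj_conj[OF N] by simp
  then have "inv_into (carrier (middle (restrict_ext X N))) (\<lambda>e. e)
      (b \<otimes>\<^bsub>middle X\<^esub> a \<otimes>\<^bsub>middle X\<^esub> inv\<^bsub>middle X\<^esub> b)
    = b \<otimes>\<^bsub>middle X\<^esub> a \<otimes>\<^bsub>middle X\<^esub> inv\<^bsub>middle X\<^esub> b"
    by (intro inv_into_f_f[where f = "\<lambda>e. e"]) simp_all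
  ultimately show "conj_map X N b a = inv_into (carrier (middle (restrict_ext X N))) (\<lambda>e. e)
      (b \<otimes>\<^bsub>middle X\<^esub> a \<otimes>\<^bsub>middle X\<^esub> inv\<^bsub>middle X\<^esub> b)"
    by (simp add: conj_map_def)
qed (use assms group_extension_restrict[OF T] group_extension_restrict[OF normal_imp_subgroup[OF N]]
  in \<open>simp_all add: group_extension_axioms hom_def\<close>)

end

lemma (in realized_triple) realizable: "realizable TYPE('e) G M act A B \<phi>"
  unfolding realizable_def
  using X.group_extension_axioms i\<^sub>1_hom i\<^sub>2_hom i\<^sub>1_inj_map i\<^sub>2_inj_map proj_i\<^sub>1 proj_i\<^sub>2 \<phi>_eq
  by (intro exI[of _ X] bexI[of _ i\<^sub>1] bexI[of _ i\<^sub>2] conjI ballI) simp_all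

lemma (in realized_triple) amalgamated_ext_restrict_congruent:
  shows "congruent_ext (G\<lparr>carrier := N\<rparr>) M act (restrict_ext Y N) A"
    and "congruent_ext (G\<lparr>carrier := T\<rparr>) M act (restrict_ext Y T) B"
  using congruent_ext_restrict[OF amalgamated_ext_congruent] subgroup_N subgroup_T
    restrict_congruent[THEN congruent_ext_sym]
  by (blast intro: congruent_ext_trans)+

theorem proposition3p4:
  fixes G :: "'g monoid" and N T :: "'g set"
    and M :: "'m monoid" and act :: "'g \<Rightarrow> 'm \<Rightarrow> 'm"
  assumes "group G" and "normal N G" and "subgroup T G"
    and "N \<inter> T = {\<one>\<^bsub>G\<^esub>}" and "N <#>\<^bsub>G\<^esub> T = carrier G"
    and "group_module G M act"
  shows "(\<forall>(E\<^sub>N :: ('m, 'n, 'g) ext_data) (E\<^sub>T :: ('m, 't, 'g) ext_data) (\<phi> :: 't \<Rightarrow> 'n \<Rightarrow> 'n).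
            group_extension (G\<lparr>carrier := N\<rparr>) M act E\<^sub>N \<longrightarrow>
            group_extension (G\<lparr>carrier := T\<rparr>) M act E\<^sub>T \<longrightarrow>
            \<phi> \<in> hom (middle E\<^sub>T) (AutM M E\<^sub>N) \<longrightarrow>
            realizable TYPE('r) G M act E\<^sub>N E\<^sub>T \<phi> \<longrightarrow>
            congruent_ext (G\<lparr>carrier := N\<rparr>) M act (restrict_ext (amalgamated_ext G M E\<^sub>N E\<^sub>T \<phi>) N) E\<^sub>N \<and>
            congruent_ext (G\<lparr>carrier := T\<rparr>) M act (restrict_ext (amalgamated_ext G M E\<^sub>N E\<^sub>T \<phi>) T) E\<^sub>T)
       \<and> (\<forall>X :: ('m, 'e, 'g) ext_data.
            group_extension G M act X \<longrightarrow>
            group_extension (G\<lparr>carrier := N\<rparr>) M act (restrict_ext X N) \<and>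
            group_extension (G\<lparr>carrier := T\<rparr>) M act (restrict_ext X T) \<and>
            conj_map X N \<in> hom (middle (restrict_ext X T)) (AutM M (restrict_ext X N)) \<and>
            realizable TYPE('e) G M act (restrict_ext X N) (restrict_ext X T) (conj_map X N) \<and>
            congruent_ext G M act X
              (amalgamated_ext G M (restrict_ext X N) (restrict_ext X T) (conj_map X N)))"
proof (intro conjI allI impI)
  note G = assms(2-5)
  fix A :: "('m, 'n, 'g) ext_data" and B :: "('m, 't, 'g) ext_data" and \<phi>
  assume A: "group_extension (G\<lparr>carrier := N\<rparr>) M act A"
    and B: "group_extension (G\<lparr>carrier := T\<rparr>) M act B"
    and "realizable TYPE('r) G M act A B \<phi>"
  then obtain X :: "('m, 'r, 'g) ext_data" and i\<^sub>1 i\<^sub>2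
    where "realized_triple G M act X N A T B \<phi> i\<^sub>1 i\<^sub>2"
    using realizableE G by blast
  then interpret realized_triple G M act X N A T B \<phi> i\<^sub>1 i\<^sub>2 .
  show "congruent_ext (G\<lparr>carrier := N\<rparr>) M act (restrict_ext (amalgamated_ext G M A B \<phi>) N) A"
    and "congruent_ext (G\<lparr>carrier := T\<rparr>) M act (restrict_ext (amalgamated_ext G M A B \<phi>) T) B"
    by (rule amalgamated_ext_restrict_congruent)+
next
  fix X :: "('m, 'e, 'g) ext_data"
  assume "group_extension G M act X"
  then interpret X: group_extension G M act X .
  interpret realized_triple G M act X N "restrict_ext X N" T "restrict_ext X T"
    "conj_map X N" "\<lambda>e. e" "\<lambda>e. e"
    using assms(2-5) by (rule X.inclusions_realize)
  show "group_extension (G\<lparr>carrier := N\<rparr>) M act (restrict_ext X N)"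
    by (rule X.group_extension_restrict[OF subgroup_N])
  show "group_extension (G\<lparr>carrier := T\<rparr>) M act (restrict_ext X T)"
    by (rule X.group_extension_restrict[OF subgroup_T])
  show "conj_map X N \<in> hom (middle (restrict_ext X T)) (AutM M (restrict_ext X N))"
    by (rule X.conj_map_hom[OF normal_N])
  show "realizable TYPE('e) G M act (restrict_ext X N) (restrict_ext X T) (conj_map X N)"
    by (rule realizable)
  show "congruent_ext G M act X
      (amalgamated_ext G M (restrict_ext X N) (restrict_ext X T) (conj_map X N))"
    by (rule congruent_ext_sym[OF amalgamated_ext_congruent])
qed

end
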